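(* Let $\alpha>1$ be a badly approximable number with continued fraction expansion $\alpha=a_0+\cfrac{1}{a_1+\cfrac{1}{a_2+\cdots}}$, where all digits $a_0,a_1,a_2,\ldots$ are positive and even. Then every half-infinite geodesic of slope $\alpha$ on the L-surface which does not hit a vertex exhibits superdensity: there is a constant $C=C(\alpha)$ such that for every integer $n\ge1$ and every point $P$ of the L-surface, the initial segment of length $Cn$ of the geodesic comes within distance $1/n$ of $P$.
   Context: The L-surface is the flat surface obtained from the three unit squares $[0,1]^2$, $[1,2]\times[0,1]$, $[0,1]\times[1,2]$ (forming an L-shape) by identifying boundary edges via translations: the left edge of $[0,1]^2$ with the right edge of $[1,2]\times[0,1]$; the left edge of $[0,1]\times[1,2]$ with its right edge; the bottom edge of $[0,1]^2$ with the top edge of $[0,1]\times[1,2]$; the bottom edge of $[1,2]\times[0,1]$ with its top edge. It is a genus-2 translation surface whose square vertices are identified to a single cone singularity. A geodesic of slope $\alpha$ is a straight-line trajectory of constant direction $(1,\alpha)$ (arc-length parametrized) on this surface. A number is badly approximable if its continued fraction digits are bounded. *)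

theory Defs
  imports "HOL-Analysis.Analysis"
begin

subsection \<open>Continued fractions\<close>

fun cfrac_convergent :: "(nat \<Rightarrow> int) \<Rightarrow> nat \<Rightarrow> real" where
  "cfrac_convergent a 0 = of_int (a 0)"
| "cfrac_convergent a (Suc n) = of_int (a 0) + 1 / cfrac_convergent (\<lambda>i. a (Suc i)) n"

definition has_cfrac :: "real \<Rightarrow> (nat \<Rightarrow> int) \<Rightarrow> bool" where
  "has_cfrac \<alpha> a \<longleftrightarrow> (\<forall>i\<ge>1. a i \<ge> 1) \<and> cfrac_convergent a \<longlonglongrightarrow> \<alpha>"

definition badly_approximable :: "real \<Rightarrow> bool" where
  "badly_approximable \<alpha> \<longleftrightarrow> (\<exists>a. has_cfrac \<alpha> a \<and> bdd_above (range a))"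


subsection \<open>The L-surface\<close>

definition L_shape :: "(real \<times> real) set" where
  "L_shape = {0..1} \<times> {0..1} \<union> {1..2} \<times> {0..1} \<union> {0..1} \<times> {1..2}"

definition L_glue :: "((real \<times> real) \<times> (real \<times> real)) set" where
  "L_glue =
     {((0, y), (2, y)) | y. 0 \<le> y \<and> y \<le> 1} \<union>
     {((0, y), (1, y)) | y. 1 \<le> y \<and> y \<le> 2} \<union>
     {((x, 0), (x, 2)) | x. 0 \<le> x \<and> x \<le> 1} \<union>
     {((x, 0), (x, 1)) | x. 1 \<le> x \<and> x \<le> 2}"

definition L_rel :: "((real \<times> real) \<times> (real \<times> real)) set" where
  "L_rel = (L_glue \<union> L_glue\<inverse>)\<^sup>* \<inter> L_shape \<times> L_shape"

definition L_surface :: "(real \<times> real) set set" where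
  "L_surface = L_shape // L_rel"

definition L_class :: "real \<times> real \<Rightarrow> (real \<times> real) set" where
  "L_class p = L_rel `` {p}"

definition L_vertices :: "(real \<times> real) set set" where
  "L_vertices = L_class ` (L_shape \<inter> \<int> \<times> \<int>)"

text \<open>
  The distance is the flat length metric, obtained as the infimum of the lengths of broken
  straight-line paths. Each segment must stay inside the (non-convex) L-shape; between two
  segments the path may pass from a boundary point to any point identified with it.
\<close>

inductive L_path :: "(real \<times> real) set \<Rightarrow> (real \<times> real) set \<Rightarrow> real \<Rightarrow> bool" where
  refl: "P \<in> L_surface \<Longrightarrow> L_path P P 0"
| step: "L_path P Q l \<Longrightarrow> p \<in> Q \<Longrightarrow> closed_segment p q \<subseteq> L_shape \<Longrightarrow>
         L_path P (L_class q) (l + dist p q)"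

definition L_dist :: "(real \<times> real) set \<Rightarrow> (real \<times> real) set \<Rightarrow> real" where
  "L_dist P Q = Inf {l. L_path P Q l}"


subsection \<open>Geodesics\<close>

definition slope_direction :: "real \<Rightarrow> real \<times> real" where
  "slope_direction \<alpha> = (1, \<alpha>) /\<^sub>R norm (1::real, \<alpha>)"

text \<open>
  A half-infinite geodesic, parametrized by arc length on \<open>{0..}\<close>; values at negative times are
  irrelevant. Locally it lifts to a straight segment in the L-shape. The lifts just before and
  just after time \<open>t\<close> are separate because they end and start at different representatives of
  \<open>\<gamma> t\<close> when an identified edge is crossed. At a non-vertex point the continuation
  is unique; for a path through a vertex it would not be.
\<close>

definition L_geodesic :: "real \<Rightarrow> (real \<Rightarrow> (real \<times> real) set) \<Rightarrow> bool" where
  "L_geodesic \<alpha> \<gamma> \<longleftrightarrow>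
     (\<forall>t\<ge>0. \<exists>p. \<exists>e>0. \<forall>s\<in>{0..e}.
        p + s *\<^sub>R slope_direction \<alpha> \<in> L_shape \<and>
        \<gamma> (t + s) = L_class (p + s *\<^sub>R slope_direction \<alpha>)) \<and>
     (\<forall>t>0. \<exists>p. \<exists>e>0. \<forall>s\<in>{0..e}.
        p - s *\<^sub>R slope_direction \<alpha> \<in> L_shape \<and>
        \<gamma> (t - s) = L_class (p - s *\<^sub>R slope_direction \<alpha>))"


subsection \<open>Basic facts\<close>

lemma L_glue_subset: "L_glue \<subseteq> L_shape \<times> L_shape"
  by (auto simp: L_glue_def L_shape_def)

lemma equiv_L_rel: "equiv L_shape L_rel"
proof (rule equivI)
  show "L_rel \<subseteq> L_shape \<times> L_shape" "refl_on L_shape L_rel"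
    by (auto simp: L_rel_def refl_on_def)
  have "sym (L_glue \<union> L_glue\<inverse>)"
    by (auto simp: sym_def)
  then show "sym L_rel"
    unfolding L_rel_def by (intro sym_Int sym_rtrancl) (auto simp: sym_def)
  show "trans L_rel"
    unfolding L_rel_def by (intro trans_Int trans_rtrancl) (auto simp: trans_def)
qed

lemma L_class_in_surface: "p \<in> L_shape \<Longrightarrow> L_class p \<in> L_surface"
  by (simp add: L_class_def L_surface_def quotientI)

lemma L_class_eqI: "(p, q) \<in> L_glue \<Longrightarrow> L_class p = L_class q"
  unfolding L_class_def
  by (rule equiv_class_eq[OF equiv_L_rel]) (use L_glue_subset in \<open>auto simp: L_rel_def\<close>)

lemma L_vertices_eq: "L_vertices = {L_class (0, 0)}"
proof -
  have glue: "L_class (0, 0) = L_class (2, 0)" "L_class (0, 1) = L_class (2, 1)"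
    "L_class (0, 1) = L_class (1, 1)" "L_class (0, 2) = L_class (1, 2)"
    "L_class (0, 0) = L_class (0, 2)" "L_class (1, 0) = L_class (1, 2)"
    "L_class (2, 0) = L_class (2, 1)"
    by (rule L_class_eqI, simp add: L_glue_def)+
  have "p \<in> {(0,0), (1,0), (2,0), (0,1), (1,1), (2,1), (0,2), (1,2)}"
    if "p \<in> L_shape \<inter> \<int> \<times> \<int>" for p
  proof -
    from that obtain i j :: int where p: "p = (of_int i, of_int j)"
      by (auto elim!: Ints_cases)
    from that have "i \<in> {0..2}" "j \<in> {0..2}" "i \<le> 1 \<or> j \<le> 1"
      by (auto simp: p L_shape_def)
    then have "i \<in> {0, 1, 2}" "j \<in> {0, 1, 2}" "i \<le> 1 \<or> j \<le> 1" by auto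
    then show ?thesis by (auto simp: p)
  qed
  then have "L_class p = L_class (0, 0)" if "p \<in> L_shape \<inter> \<int> \<times> \<int>" for p
    using that glue by fastforce
  moreover have "(0, 0) \<in> L_shape \<inter> \<int> \<times> \<int>"
    by (simp add: L_shape_def)
  ultimately show ?thesis
    unfolding L_vertices_def by blast
qed

lemma L_path_nonneg: "L_path P Q l \<Longrightarrow> 0 \<le> l"
  by (induction rule: L_path.induct) auto

end

theory Submission
  imports Defs
begin

text \<open>
  Let \<open>h\<close> and \<open>v\<close> be the permutations of the three squares given by stepping to the
  right and up. Both are involutions, so for even \<open>a\<close> the shear
  \<open>(x, y) \<mapsto> (x, y - a x)\<close>, followed by exchanging the axes, is realized by an affine
  automorphism of the surface. It changes the slope \<open>a + 1 / \<beta>\<close> into \<open>\<beta>\<close>. After \<open>k\<close> such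
  steps, an initial segment of the geodesic of length comparable to \<open>n\<close> has bounded length,
  and the slope is still at least 2. Looking at three consecutive steps, such a segment crosses each of
  the three squares from bottom to top. At the same time a vertical segment of length \<open>1 / n\<close>
  starting at \<open>P\<close> becomes a segment of slope in \<open>{-1/2..0}\<close> which is long enough to cross some
  square from left to right. The two meet in that square.
\<close>

section \<open>Continued fractions\<close>

lemma cfrac_convergent_ge:
  assumes "\<And>i. a i \<ge> 1"
  shows "cfrac_convergent a n \<ge> of_int (a 0)"
  using assms
proof (induction n arbitrary: a)
  case (Suc n)
  have "cfrac_convergent (\<lambda>i. a (Suc i)) n \<ge> of_int (a (Suc 0))"
    using Suc.IH[of "\<lambda>i. a (Suc i)"] Suc.prems by simp
  moreover have "(of_int (a (Suc 0)) :: real) \<ge> 1"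
    using Suc.prems[of "Suc 0"] by linarith
  ultimately show ?case by simp
qed simp

text \<open>The reciprocals of the tail's convergents tend to \<open>x - a 0\<close>. These
  convergents are at most \<open>a 1 + 1\<close>, so that limit is positive and taking reciprocals
  preserves convergence.\<close>

lemma has_cfrac_tail:
  assumes "has_cfrac x a"
  shows "x > of_int (a 0)" "has_cfrac (1 / (x - of_int (a 0))) (\<lambda>i. a (Suc i))"
proof -
  define c where "c = cfrac_convergent (\<lambda>i. a (Suc i))"
  have lim: "cfrac_convergent a \<longlonglongrightarrow> x"
    using assms by (simp add: has_cfrac_def)
  have pos: "a i \<ge> 1" if "i \<ge> 1" for i
    using assms that by (simp add: has_cfrac_def)
  have a1: "(of_int (a (Suc 0)) :: real) \<ge> 1"
    using pos[of "Suc 0"] by linarith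
  have c_ge: "c n \<ge> of_int (a (Suc 0))" for n
    unfolding c_def using cfrac_convergent_ge[of "\<lambda>i. a (Suc i)"] pos by simp
  have c_le: "c n \<le> of_int (a (Suc 0)) + 1" for n
  proof (cases n)
    case (Suc m)
    have "cfrac_convergent (\<lambda>i. a (Suc (Suc i))) m \<ge> of_int (a (Suc (Suc 0)))"
      using cfrac_convergent_ge[of "\<lambda>i. a (Suc (Suc i))"] pos by simp
    moreover have "(of_int (a (Suc (Suc 0))) :: real) \<ge> 1"
      using pos[of "Suc (Suc 0)"] by linarith
    ultimately show ?thesis by (simp add: c_def Suc divide_le_eq)
  qed (simp add: c_def)
  have shift: "(\<lambda>n. 1 / c n) \<longlonglongrightarrow> x - of_int (a 0)"
  proof -
    have "(\<lambda>n. cfrac_convergent a (Suc n) - of_int (a 0)) \<longlonglongrightarrow> x - of_int (a 0)"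
      using lim by (intro tendsto_diff tendsto_const) (rule LIMSEQ_Suc)
    then show ?thesis by (simp add: c_def)
  qed
  have "1 / (of_int (a (Suc 0)) + 1) \<le> 1 / c n" for n
    using c_le[of n] c_ge[of n] a1 by (intro divide_left_mono) auto
  then have "1 / (of_int (a (Suc 0)) + 1) \<le> x - of_int (a 0)"
    by (intro LIMSEQ_le_const[OF shift]) auto
  moreover have "1 / (of_int (a (Suc 0)) + 1) > (0 :: real)"
    using a1 by simp
  ultimately show gt: "x > of_int (a 0)" by linarith
  have "(\<lambda>n. 1 / (1 / c n)) \<longlonglongrightarrow> 1 / (x - of_int (a 0))"
    using gt by (intro tendsto_divide tendsto_const shift) auto
  then have "c \<longlonglongrightarrow> 1 / (x - of_int (a 0))" by simp
  then show "has_cfrac (1 / (x - of_int (a 0))) (\<lambda>i. a (Suc i))"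
    unfolding has_cfrac_def c_def using pos by simp
qed

text \<open>Strict because the tail exceeds its own leading digit, which is at least 1. Together
  with the lower bound this makes the digit a floor.\<close>

lemma has_cfrac_less:
  assumes "has_cfrac x a"
  shows "x < of_int (a 0) + 1"
proof -
  note 1 = has_cfrac_tail[OF assms]
  have "1 / (x - of_int (a 0)) > of_int (a (Suc 0))"
    using has_cfrac_tail(1)[OF 1(2)] by simp
  moreover have "a (Suc 0) \<ge> 1" using assms by (simp add: has_cfrac_def)
  then have "(of_int (a (Suc 0)) :: real) \<ge> 1" by linarith
  ultimately have "1 / (x - of_int (a 0)) > 1" by linarith
  then show ?thesis using 1(1) by (simp add: field_simps)
qed

section \<open>Complete quotients and uniqueness of the digits\<close>

primrec complete_quotient :: "real \<Rightarrow> (nat \<Rightarrow> int) \<Rightarrow> nat \<Rightarrow> real" where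
  "complete_quotient x a 0 = x"
| "complete_quotient x a (Suc k) = 1 / (complete_quotient x a k - of_int (a k))"

lemma has_cfrac_complete_quotient:
  "has_cfrac x a \<Longrightarrow> has_cfrac (complete_quotient x a k) (\<lambda>i. a (i + k))"
proof (induction k)
  case (Suc k)
  then show ?case using has_cfrac_tail(2)[of _ "\<lambda>i. a (i + k)"] by simp
qed simp

lemma complete_quotient_bounds:
  assumes "has_cfrac x a"
  shows "of_int (a k) < complete_quotient x a k" "complete_quotient x a k < of_int (a k) + 1"
  using has_cfrac_tail(1)[OF has_cfrac_complete_quotient[OF assms, of k]]
    has_cfrac_less[OF has_cfrac_complete_quotient[OF assms, of k]] by simp_all

text \<open>Each digit is the floor of a complete quotient, and that quotient is determined by
  \<open>x\<close> and the earlier digits. This transfers the digit bound from the expansion hidden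
  in \<open>badly_approximable\<close> to the given one.\<close>

lemma has_cfrac_unique:
  assumes "has_cfrac x a" "has_cfrac x b"
  shows "a = b"
proof -
  have *: "a k = b k" if "complete_quotient x a k = complete_quotient x b k" for k
  proof -
    have "a k = \<lfloor>complete_quotient x a k\<rfloor>" "b k = \<lfloor>complete_quotient x b k\<rfloor>"
      using complete_quotient_bounds[OF assms(1), of k] complete_quotient_bounds[OF assms(2), of k]
      by linarith+
    with that show ?thesis by simp
  qed
  have "complete_quotient x a k = complete_quotient x b k" for k
    by (induction k) (auto dest: *)
  then show ?thesis using * by blast
qed

section \<open>Charts by three glued unit squares\<close>

datatype square = Corner | East | North

fun right_of :: "square \<Rightarrow> square" where
  "right_of Corner = East" | "right_of East = Corner" | "right_of North = North"

fun above :: "square \<Rightarrow> square" where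
  "above Corner = North" | "above North = Corner" | "above East = East"

fun flip :: "square \<Rightarrow> square" where
  "flip Corner = Corner" | "flip East = North" | "flip North = East"

lemma above_above [simp]: "above (above s) = s" by (cases s) auto
lemma flip_flip [simp]: "flip (flip s) = s" by (cases s) auto
lemma flip_above: "flip (above s) = right_of (flip s)" by (cases s) auto
lemma flip_right_of: "flip (right_of s) = above (flip s)" by (cases s) auto

text \<open>The \<open>j\<close>-fold iterate of \<open>above\<close>, also for negative
  \<open>j\<close>; the parity decides because \<open>above\<close> is an involution.\<close>

definition climb :: "int \<Rightarrow> square \<Rightarrow> square" where
  "climb j s = (if even j then s else above s)"

lemma climb_climb [simp]: "climb i (climb j s) = climb (i + j) s"
  by (auto simp: climb_def)

lemma climb_0 [simp]: "climb 0 s = s" and climb_1 [simp]: "climb 1 s = above s"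
  by (auto simp: climb_def)

lemma climb_East [simp]: "climb j East = East"
  by (simp add: climb_def)

lemma above_climb: "above (climb j s) = climb (j + 1) s"
  by (auto simp: climb_def)

text \<open>A system of coordinates: two real coordinates in the unit interval and the label of a
  square give a point of the surface.\<close>

type_synonym 'p sheets = "real \<Rightarrow> real \<Rightarrow> square \<Rightarrow> 'p"

definition glued :: "'p sheets \<Rightarrow> bool" where
  "glued \<psi> \<longleftrightarrow> (\<forall>s. \<forall>z\<in>{0..1}. \<psi> 1 z s = \<psi> 0 z (right_of s) \<and> \<psi> z 1 s = \<psi> z 0 (above s))"

definition covers :: "'p sheets \<Rightarrow> 'p set \<Rightarrow> bool" where
  "covers \<psi> S \<longleftrightarrow> (\<forall>P\<in>S. \<exists>x\<in>{0..1}. \<exists>y\<in>{0..1}. \<exists>s. P = \<psi> x y s)"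

text \<open>Motion with velocity \<open>(u, w)\<close> inside one square, for time \<open>r\<close>,
  is recorded by \<open>Q\<close>. The relation is left abstract so that one renormalization
  argument serves both the flow along the geodesic (\<open>follows\<close>) and the length of paths
  (\<open>path_back\<close>).\<close>

definition chart :: "'p sheets \<Rightarrow> real \<Rightarrow> real \<Rightarrow> ('p \<Rightarrow> 'p \<Rightarrow> real \<Rightarrow> bool) \<Rightarrow> bool" where
  "chart \<psi> u w Q \<longleftrightarrow> (\<forall>x y s r. 0 \<le> r \<and> x \<in> {0..1} \<and> y \<in> {0..1} \<and> x + r * u \<in> {0..1} \<and> y + r * w \<in> {0..1}
     \<longrightarrow> Q (\<psi> x y s) (\<psi> (x + r * u) (y + r * w) s) r)"

definition additive :: "('p \<Rightarrow> 'p \<Rightarrow> real \<Rightarrow> bool) \<Rightarrow> bool" where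
  "additive Q \<longleftrightarrow> (\<forall>P P' P'' r r'. 0 \<le> r \<and> 0 \<le> r' \<and> Q P P' r \<and> Q P' P'' r' \<longrightarrow> Q P P'' (r + r'))"

text \<open>Unfolds the vertical cylinder through \<open>s\<close> into an infinite strip of width
  1.\<close>

definition strip :: "'p sheets \<Rightarrow> 'p sheets" where
  "strip \<psi> x y s = \<psi> x (frac y) (climb \<lfloor>y\<rfloor> s)"

text \<open>The new coordinates are \<open>(y - a x, x)\<close> in terms of the old
  \<open>(x, y)\<close>; the formula is the inverse of this change. The label is flipped because
  exchanging the axes exchanges \<open>right_of\<close> and \<open>above\<close>.\<close>

definition renorm :: "int \<Rightarrow> 'p sheets \<Rightarrow> 'p sheets" where
  "renorm a \<psi> x y s = strip \<psi> y (x + of_int a * y) (flip s)"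

lemma gluedD:
  assumes "glued \<psi>" "z \<in> {0..1}"
  shows "\<psi> 1 z s = \<psi> 0 z (right_of s)" "\<psi> z 1 s = \<psi> z 0 (above s)"
  using assms by (auto simp: glued_def)

lemma chartD:
  assumes "chart \<psi> u w Q" "0 \<le> r" "x \<in> {0..1}" "y \<in> {0..1}" "x + r * u \<in> {0..1}" "y + r * w \<in> {0..1}"
  shows "Q (\<psi> x y s) (\<psi> (x + r * u) (y + r * w) s) r"
  using assms unfolding chart_def by blast

text \<open>The floor in \<open>strip\<close> selects half-open cells; gluing makes the formula
  valid on the upper edge too, so adjacent closed cells share their boundary.\<close>

lemma strip_cell:
  assumes "glued \<psi>" "x \<in> {0..1}" "of_int j \<le> y" "y \<le> of_int j + 1"
  shows "strip \<psi> x y s = \<psi> x (y - of_int j) (climb j s)"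
proof (cases "y = of_int j + 1")
  case True
  then have "\<lfloor>y\<rfloor> = j + 1" by linarith
  then show ?thesis
    using gluedD(2)[OF assms(1,2)] True by (simp add: strip_def frac_def above_climb)
next
  case False
  then have "\<lfloor>y\<rfloor> = j" using assms by linarith
  then show ?thesis by (simp add: strip_def frac_def)
qed

lemma strip_unit:
  assumes "glued \<psi>" "x \<in> {0..1}" "y \<in> {0..1}"
  shows "strip \<psi> x y s = \<psi> x y s"
  using strip_cell[of \<psi> x 0 y] assms by simp

section \<open>Straight segments in the unfolded strip\<close>

lemma convex_unit:
  fixes x r r' u :: real
  assumes "x \<in> {0..1}" "x + r * u \<in> {0..1}" "0 \<le> r'" "r' \<le> r"
  shows "x + r' * u \<in> {0..1}"
proof (cases "u \<ge> 0")
  case True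
  then have "0 \<le> r' * u" "r' * u \<le> r * u" using assms by (auto intro: mult_right_mono)
  then show ?thesis using assms by auto
next
  case False
  then have "r' * u \<le> 0" "r * u \<le> r' * u" using assms
    by (auto intro: mult_right_mono_neg simp: mult_nonneg_nonpos)
  then show ?thesis using assms by auto
qed

text \<open>Induction on the number of stacked cells that contain the segment: it is cut where it
  enters or leaves the top cell, and the two pieces are joined by additivity.\<close>

lemma chart_strip_aux:
  assumes "glued \<psi>" "chart \<psi> u w Q" "additive Q"
    and "0 \<le> r" "x \<in> {0..1}" "x + r * u \<in> {0..1}"
    and "y \<in> {of_int j..of_int j + real n}" "y + r * w \<in> {of_int j..of_int j + real n}"
  shows "Q (strip \<psi> x y s) (strip \<psi> (x + r * u) (y + r * w) s) r"
  using assms(4-)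
proof (induction n arbitrary: x y r)
  case (Suc n)
  have cell: "Q (strip \<psi> x y s) (strip \<psi> (x + r * u) (y + r * w) s) r"
    if "0 \<le> r" "x \<in> {0..1}" "x + r * u \<in> {0..1}"
      "y \<in> {of_int i..of_int i + 1}" "y + r * w \<in> {of_int i..of_int i + 1}" for i x y r
    using chartD[OF assms(2) that(1,2), of "y - of_int i" "climb i s"] that
      strip_cell[OF assms(1) that(2), of i y] strip_cell[OF assms(1) that(3), of i "y + r * w"]
    by (auto simp: algebra_simps)
  \<comment> \<open>Height of the lower edge of the top cell, along which the segment is
    cut.\<close>
  define i where "i = j + int n"
  have i: "(of_int i :: real) = of_int j + real n" by (simp add: i_def)
  consider "y \<le> of_int i" "y + r * w \<le> of_int i" | "y \<ge> of_int i" "y + r * w \<ge> of_int i"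
    | "y < of_int i" "y + r * w > of_int i" | "y > of_int i" "y + r * w < of_int i"
    by linarith
  then show ?case
  proof cases
    case 1
    with Suc show ?thesis by (auto simp: i)
  next
    case 2
    with Suc.prems show ?thesis by (intro cell[of _ _ _ i]) (auto simp: i)
  next
    case 3
    then have "r * w > 0" by linarith
    then have w: "w > 0" "r > 0" using Suc.prems by (auto simp: zero_less_mult_iff)
    define r' where "r' = (of_int i - y) / w"
    have r': "0 \<le> r'" "r' \<le> r" "y + r' * w = of_int i"
      using w 3 by (auto simp: r'_def field_simps)
    have x': "x + r' * u \<in> {0..1}"
      using convex_unit[OF Suc.prems(2,3) r'(1,2)] .
    have 1: "Q (strip \<psi> x y s) (strip \<psi> (x + r' * u) (y + r' * w) s) r'"
      using Suc.prems r' x' 3 by (intro Suc.IH) (auto simp: i)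
    have 2: "Q (strip \<psi> (x + r' * u) (y + r' * w) s)
       (strip \<psi> (x + r' * u + (r - r') * u) (y + r' * w + (r - r') * w) s) (r - r')"
      using Suc.prems r' x' 3 by (intro cell[of _ _ _ i]) (auto simp: i algebra_simps)
    have "Q (strip \<psi> x y s)
      (strip \<psi> (x + r' * u + (r - r') * u) (y + r' * w + (r - r') * w) s) (r' + (r - r'))"
      using 1 2 r' assms(3) unfolding additive_def by (meson diff_ge_0_iff_ge)
    then show ?thesis by (simp add: algebra_simps)
  next
    case 4
    then have "r * w < 0" by linarith
    then have w: "w < 0" "r > 0" using Suc.prems by (auto simp: mult_less_0_iff)
    define r' where "r' = (of_int i - y) / w"
    have r': "0 \<le> r'" "r' \<le> r" "y + r' * w = of_int i"
      using w 4 by (auto simp: r'_def field_simps)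
    have x': "x + r' * u \<in> {0..1}"
      using convex_unit[OF Suc.prems(2,3) r'(1,2)] .
    have 1: "Q (strip \<psi> x y s) (strip \<psi> (x + r' * u) (y + r' * w) s) r'"
      using Suc.prems r' x' 4 by (intro cell[of _ _ _ i]) (auto simp: i algebra_simps)
    have 2: "Q (strip \<psi> (x + r' * u) (y + r' * w) s)
       (strip \<psi> (x + r' * u + (r - r') * u) (y + r' * w + (r - r') * w) s) (r - r')"
      using Suc.prems r' x' 4 by (intro Suc.IH) (auto simp: i algebra_simps)
    have "Q (strip \<psi> x y s)
      (strip \<psi> (x + r' * u + (r - r') * u) (y + r' * w + (r - r') * w) s) (r' + (r - r'))"
      using 1 2 r' assms(3) unfolding additive_def by (meson diff_ge_0_iff_ge)
    then show ?thesis by (simp add: algebra_simps)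
  qed
next
  case 0
  then have "y = of_int j" "y + r * w = of_int j" by auto
  then show ?case
    using chartD[OF assms(2) 0(1,2), of 0 "climb j s"] 0(3)
      strip_cell[OF assms(1) 0(2), of j y] strip_cell[OF assms(1) 0(3), of j "y + r * w"]
    by auto
qed

lemma chart_strip:
  assumes "glued \<psi>" "chart \<psi> u w Q" "additive Q"
    and "0 \<le> r" "x \<in> {0..1}" "x + r * u \<in> {0..1}"
  shows "Q (strip \<psi> x y s) (strip \<psi> (x + r * u) (y + r * w) s) r"
proof (rule chart_strip_aux[OF assms])
  define j where "j = min \<lfloor>y\<rfloor> \<lfloor>y + r * w\<rfloor>"
  define n where "n = nat (max \<lceil>y\<rceil> \<lceil>y + r * w\<rceil> - j)"
  have "j \<le> y" "j \<le> y + r * w" "y \<le> j + n" "y + r * w \<le> j + n"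
    unfolding n_def j_def by linarith+
  then show "y \<in> {of_int j..of_int j + real n}" "y + r * w \<in> {of_int j..of_int j + real n}"
    by auto
qed

text \<open>A renormalized square is a parallelogram in a strip of the old chart, possibly spanning
  many cells, which \<open>chart_strip\<close> permits. The linear part of the coordinate change
  turns the velocity \<open>(u, w)\<close> into \<open>(w - a u, u)\<close>.\<close>

lemma chart_renorm:
  assumes "glued \<psi>" "chart \<psi> u w Q" "additive Q"
  shows "chart (renorm a \<psi>) (w - of_int a * u) u Q"
  unfolding chart_def renorm_def
proof (intro allI impI, elim conjE)
  fix x y s r
  assume "0 \<le> (r::real)" "y \<in> {0..1}" "y + r * u \<in> {0..1}"
  from chart_strip[OF assms this, of "x + of_int a * y" "flip s"]
  show "Q (strip \<psi> y (x + of_int a * y) (flip s))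
     (strip \<psi> (y + r * u) (x + r * (w - of_int a * u) + of_int a * (y + r * u)) (flip s)) r"
    by (simp add: algebra_simps)
qed

section \<open>Gluing and covering after renormalization\<close>

lemma strip_shift:
  "strip \<psi> x (y + of_int j) s = strip \<psi> x y (climb j s)"
  by (simp add: strip_def frac_def algebra_simps)

text \<open>Here evenness enters: over the unit width the shear displaces one vertical edge by
  \<open>a\<close> cells against the other, and an even number of climbs returns to the same
  square.\<close>

lemma glued_renorm:
  assumes "glued \<psi>" "even a"
  shows "glued (renorm a \<psi>)"
  unfolding glued_def
proof (intro allI ballI conjI)
  fix s and z :: real assume z: "z \<in> {0..1}"
  show "renorm a \<psi> 1 z s = renorm a \<psi> 0 z (right_of s)"
    using strip_shift[of \<psi> z "of_int a * z" 1 "flip s"]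
    by (simp add: renorm_def flip_right_of add.commute)
  have "renorm a \<psi> z 1 s = strip \<psi> 1 z (flip s)"
    using strip_shift[of \<psi> 1 z a "flip s"] assms(2)
    by (simp add: renorm_def climb_def)
  also have "\<dots> = \<psi> 1 z (flip s)"
    using strip_unit[OF assms(1)] z by simp
  also have "\<dots> = \<psi> 0 z (flip (above s))"
    using gluedD[OF assms(1)] z by (simp add: flip_above)
  also have "\<dots> = renorm a \<psi> z 0 (above s)"
    using strip_unit[OF assms(1)] z by (simp add: renorm_def)
  finally show "renorm a \<psi> z 1 s = renorm a \<psi> z 0 (above s)" .
qed

lemma covers_renorm:
  assumes "glued \<psi>" "covers \<psi> S"
  shows "covers (renorm a \<psi>) S"
  unfolding covers_def
proof
  fix P assume "P \<in> S"
  then obtain x y s where x: "x \<in> {0..1}" and y: "y \<in> {0..1}" and P: "P = \<psi> x y s"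
    using assms(2) unfolding covers_def by blast
  \<comment> \<open>The old coordinates are sheared back; the integer part removed by
    \<open>frac\<close> is restored by climbing \<open>j\<close> cells.\<close>
  define j where "j = \<lfloor>y - of_int a * x\<rfloor>"
  have "renorm a \<psi> (frac (y - of_int a * x)) x (flip (climb j s))
      = strip \<psi> x (y + of_int (- j)) (climb j s)"
    by (simp add: renorm_def frac_def j_def)
  also have "\<dots> = P"
    using strip_shift[of \<psi> x y "- j"] strip_unit[OF assms(1) x y] P by (simp add: climb_def)
  finally show "\<exists>x\<in>{0..1}. \<exists>y\<in>{0..1}. \<exists>s. P = renorm a \<psi> x y s"
    using x frac_ge_0 frac_lt_1 by (metis atLeastAtMost_iff less_eq_real_def)
qed

lemma renorm_bottom:
  assumes "glued \<psi>" "x \<in> {0..1}"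
  shows "renorm a \<psi> x 0 s = \<psi> 0 x (flip s)"
  using strip_unit[OF assms(1)] assms(2) by (simp add: renorm_def)

section \<open>A trajectory crosses all squares\<close>

text \<open>Quantifying over every nonnegative time spent at \<open>P\<close> is what lets
  consecutive pieces compose.\<close>

definition follows :: "(real \<Rightarrow> 'p) \<Rightarrow> 'p \<Rightarrow> 'p \<Rightarrow> real \<Rightarrow> bool" where
  "follows \<gamma> P P' r \<longleftrightarrow> (\<forall>t\<ge>0. \<gamma> t = P \<longrightarrow> \<gamma> (t + r) = P')"

lemma additive_follows: "additive (follows \<gamma>)"
  unfolding additive_def
proof (intro allI impI, elim conjE)
  fix P P' P'' and r r' :: real
  assume "0 \<le> r" "follows \<gamma> P P' r" "follows \<gamma> P' P'' r'"
  then show "follows \<gamma> P P'' (r + r')"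
    by (simp add: follows_def flip: add.assoc)
qed

section \<open>Visits to edges and crossings of squares\<close>

definition left_visit :: "'p sheets \<Rightarrow> (real \<Rightarrow> 'p) \<Rightarrow> real \<Rightarrow> square \<Rightarrow> bool" where
  "left_visit \<psi> \<gamma> T s \<longleftrightarrow> (\<exists>t\<in>{0..T}. \<exists>y\<in>{0..1}. \<gamma> t = \<psi> 0 y s)"

definition bottom_visit :: "'p sheets \<Rightarrow> (real \<Rightarrow> 'p) \<Rightarrow> real \<Rightarrow> square \<Rightarrow> bool" where
  "bottom_visit \<psi> \<gamma> T s \<longleftrightarrow> (\<exists>t\<in>{0..T}. \<exists>x\<in>{0..1}. \<gamma> t = \<psi> x 0 s)"

text \<open>At slope \<open>b\<close> the top edge is reached after horizontal distance
  \<open>1 / b\<close>. The bound on \<open>x\<close> thus ensures that the path goes from the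
  bottom of the square to its top without leaving through the right edge.\<close>

definition crossing :: "'p sheets \<Rightarrow> (real \<Rightarrow> 'p) \<Rightarrow> real \<Rightarrow> real \<Rightarrow> square \<Rightarrow> bool" where
  "crossing \<psi> \<gamma> b T s \<longleftrightarrow> (\<exists>t\<in>{0..T}. \<exists>x\<in>{0..1 - 1 / b}. \<gamma> t = \<psi> x 0 s)"

lemma bottom_visit_mono: "bottom_visit \<psi> \<gamma> T s \<Longrightarrow> T \<le> T' \<Longrightarrow> bottom_visit \<psi> \<gamma> T' s"
  unfolding bottom_visit_def by force

lemma bottom_visit_renorm:
  assumes "glued \<psi>" "bottom_visit (renorm a \<psi>) \<gamma> T s"
  shows "left_visit \<psi> \<gamma> T (flip s)"
proof -
  obtain t x where tx: "t \<in> {0..T}" "x \<in> {0..1}" "\<gamma> t = renorm a \<psi> x 0 s"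
    using assms(2) unfolding bottom_visit_def by blast
  then have "\<gamma> t = \<psi> 0 x (flip s)"
    using renorm_bottom[OF assms(1) tx(2)] by simp
  with tx show ?thesis unfolding left_visit_def by blast
qed

text \<open>\<open>l\<close> is the horizontal speed and \<open>b\<close> the slope. With
  \<open>b \<ge> 2\<close> the path climbs at least two units while it advances by one.\<close>

locale trajectory =
  fixes \<psi> :: "'p sheets" and \<gamma> :: "real \<Rightarrow> 'p" and l b :: real
  assumes glued: "glued \<psi>"
    and chart: "chart \<psi> l (l * b) (follows \<gamma>)"
    and pos: "l > 0"
    and slope: "b \<ge> 2"
begin

lemma move:
  assumes "\<gamma> t = \<psi> x y s" "t \<ge> 0" "r \<ge> 0" "x \<in> {0..1}" "y \<in> {0..1}"
    "x + r * l \<in> {0..1}" "y + r * (l * b) \<in> {0..1}"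
  shows "\<gamma> (t + r) = \<psi> (x + r * l) (y + r * (l * b)) s"
  using chartD[OF chart assms(3-), of s] assms(1,2) by (auto simp: follows_def)

lemma move_to_left:
  assumes "\<gamma> t = \<psi> x y s" "t \<ge> 0" "x \<in> {0..1}" "y \<in> {0..1}"
  shows "\<exists>y'\<in>{0..1}. \<exists>j. \<gamma> (t + (1 - x) / l) = \<psi> 0 y' (right_of (climb j s))"
proof -
  define y' where "y' = y + (1 - x) / l * (l * b)"
  have "follows \<gamma> (strip \<psi> x y s) (strip \<psi> (x + (1 - x) / l * l) y' s) ((1 - x) / l)"
    unfolding y'_def using pos assms(3)
    by (intro chart_strip[OF glued chart additive_follows]) auto
  then have "\<gamma> (t + (1 - x) / l) = strip \<psi> 1 y' s"
    using strip_unit[OF glued assms(3,4)] assms(1,2) pos by (simp add: follows_def)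
  also have "\<dots> = \<psi> 0 (frac y') (right_of (climb \<lfloor>y'\<rfloor> s))"
    using gluedD(1)[OF glued] frac_ge_0[of y'] frac_lt_1[of y']
    by (simp add: strip_def less_imp_le)
  finally show ?thesis
    using frac_ge_0[of y'] frac_lt_1[of y'] by (meson atLeastAtMost_iff less_imp_le)
qed

lemma ex_left_visit:
  assumes "covers \<psi> S" "\<gamma> 0 \<in> S"
  shows "\<exists>s. left_visit \<psi> \<gamma> (1 / l) s"
proof -
  obtain x y s where *: "x \<in> {0..1}" "y \<in> {0..1}" "\<gamma> 0 = \<psi> x y s"
    using assms unfolding covers_def by blast
  have "(1 - x) / l \<in> {0..1 / l}"
    using *(1) pos by (auto simp: divide_right_mono)
  with move_to_left[OF *(3) _ *(1,2)] show ?thesis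
    unfolding left_visit_def by force
qed

text \<open>\<open>East\<close> lies above itself, so a path that enters it from the left stays in
  it until it passes through the right edge into \<open>Corner\<close>.\<close>

lemma left_visit_East:
  assumes "left_visit \<psi> \<gamma> T East"
  shows "left_visit \<psi> \<gamma> (T + 1 / l) Corner"
proof -
  obtain t y where *: "t \<in> {0..T}" "y \<in> {0..1}" "\<gamma> t = \<psi> 0 y East"
    using assms unfolding left_visit_def by blast
  have "t + 1 / l \<in> {0..T + 1 / l}" using * pos by auto
  with move_to_left[OF *(3)] * show ?thesis
    unfolding left_visit_def by force
qed

text \<open>From height \<open>y\<close> on the left edge, the top of \<open>s\<close> is reached
  after horizontal distance \<open>(1 - y) / b\<close>, and the top of \<open>above s\<close> after
  a further \<open>1 / b\<close>. The total is at most \<open>2 / b \<le> 1\<close>, and the last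
  edge is again the bottom of \<open>s\<close>.\<close>

lemma left_visit_crossing:
  assumes "left_visit \<psi> \<gamma> T s"
  shows "crossing \<psi> \<gamma> b (T + 1 / l) (above s)" "bottom_visit \<psi> \<gamma> (T + 1 / l) (above s)"
    "bottom_visit \<psi> \<gamma> (T + 1 / l) s"
proof -
  obtain t y where *: "t \<in> {0..T}" "y \<in> {0..1}" "\<gamma> t = \<psi> 0 y s"
    using assms unfolding left_visit_def by blast
  have b: "1 / b \<le> 1 / 2" using slope by (intro divide_left_mono) auto
  define x where "x = (1 - y) / b"
  have "x \<le> 1 / b" unfolding x_def using * slope by (intro divide_right_mono) auto
  moreover have "x \<ge> 0" using * slope by (simp add: x_def)
  ultimately have x: "x \<in> {0..1 - 1 / b}" "x \<in> {0..1}" "x + 1 / b \<in> {0..1}" using b by auto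
  have x1: "x \<le> 1/2" "x + 1 / b \<le> 1" using \<open>x \<le> 1 / b\<close> b by auto
  have "\<gamma> (t + x / l) = \<psi> (0 + x / l * l) (y + x / l * (l * b)) s"
    using * x pos slope by (intro move) (auto simp: x_def)
  then have 1: "\<gamma> (t + x / l) = \<psi> x 0 (above s)"
    using pos slope gluedD(2)[OF glued x(2)] by (simp add: x_def)
  have "\<gamma> (t + x / l + 1 / b / l) = \<psi> (x + 1 / b / l * l) (0 + 1 / b / l * (l * b)) (above s)"
    using * 1 x pos slope by (intro move) auto
  then have 2: "\<gamma> (t + x / l + 1 / b / l) = \<psi> (x + 1 / b) 0 s"
    using pos slope gluedD(2)[OF glued x(3)] by simp
  have "x / l \<le> 1 / l" using x1 pos by (intro divide_right_mono) auto
  moreover have "(x + 1 / b) / l \<le> 1 / l" using x1 pos by (intro divide_right_mono) auto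
  ultimately have "x / l \<le> 1 / l" "x / l + 1 / b / l \<le> 1 / l"
    by (simp_all add: add_divide_distrib)
  then have t: "t + x / l \<in> {0..T + 1 / l}" "t + x / l + 1 / b / l \<in> {0..T + 1 / l}"
    using * x pos slope by auto
  show "crossing \<psi> \<gamma> b (T + 1 / l) (above s)"
    unfolding crossing_def using 1 t x by blast
  show "bottom_visit \<psi> \<gamma> (T + 1 / l) (above s)" "bottom_visit \<psi> \<gamma> (T + 1 / l) s"
    unfolding bottom_visit_def using 1 2 t x by blast+
qed

text \<open>Some left edge is met by time \<open>1 / l\<close>. From \<open>Corner\<close> or
  \<open>North\<close> the path then meets the bottom of \<open>North\<close> within another
  \<open>1 / l\<close>; from \<open>East\<close> it first passes into \<open>Corner\<close>.\<close>

lemma bottom_visit_North: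
  assumes "covers \<psi> S" "\<gamma> 0 \<in> S"
  shows "bottom_visit \<psi> \<gamma> (3 / l) North"
proof -
  obtain s where s: "left_visit \<psi> \<gamma> (1 / l) s" using ex_left_visit[OF assms] ..
  show ?thesis
  proof (cases s)
    case East
    with left_visit_crossing(2)[OF left_visit_East] s show ?thesis by fastforce
  next
    case Corner
    with left_visit_crossing(2)[OF s] have "bottom_visit \<psi> \<gamma> (2 / l) North" by simp
    then show ?thesis by (rule bottom_visit_mono) (use pos in \<open>simp add: divide_right_mono\<close>)
  next
    case North
    with left_visit_crossing(3)[OF s] have "bottom_visit \<psi> \<gamma> (2 / l) North" by simp
    then show ?thesis by (rule bottom_visit_mono) (use pos in \<open>simp add: divide_right_mono\<close>)
  qed
qed

text \<open>The bottom of \<open>East\<close> is met before the path moves on to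
  \<open>Corner\<close>, and the bottoms of the other two squares after that.\<close>

lemma all_bottom_visit:
  assumes "left_visit \<psi> \<gamma> T East"
  shows "bottom_visit \<psi> \<gamma> (T + 2 / l) s"
proof -
  have "bottom_visit \<psi> \<gamma> (T + 1 / l) East"
    using left_visit_crossing(3)[OF assms] .
  moreover have "T + 1 / l \<le> T + 2 / l" using pos by (simp add: divide_right_mono)
  ultimately have "bottom_visit \<psi> \<gamma> (T + 2 / l) East"
    by (rule bottom_visit_mono)
  moreover have "bottom_visit \<psi> \<gamma> (T + 2 / l) Corner" "bottom_visit \<psi> \<gamma> (T + 2 / l) North"
    using left_visit_crossing(2,3)[OF left_visit_East[OF assms]]
    by (simp_all add: add.assoc flip: add_divide_distrib)
  ultimately show ?thesis by (cases s) auto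
qed

end

text \<open>
  Vertical crossings at one stage are obtained from the two following ones: the bottom edges of a
  renormalized chart are left edges of the original one. At the last stage some visit to a left
  edge leads to \<open>North\<close>, that is, to the left edge of \<open>East\<close> one stage earlier.
\<close>

lemma all_crossings:
  fixes l l1 l2 b b1 b2 :: real
  assumes "trajectory \<psi> \<gamma> l b" "trajectory (renorm a \<psi>) \<gamma> l1 b1"
    "trajectory (renorm a1 (renorm a \<psi>)) \<gamma> l2 b2"
    and "covers (renorm a1 (renorm a \<psi>)) S" "\<gamma> 0 \<in> S"
    and "l2 \<le> l1" "l1 \<le> l"
  shows "crossing \<psi> \<gamma> b (6 / l2) s"
proof -
  interpret s0: trajectory \<psi> \<gamma> l b by fact
  interpret s1: trajectory "renorm a \<psi>" \<gamma> l1 b1 by fact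
  interpret s2: trajectory "renorm a1 (renorm a \<psi>)" \<gamma> l2 b2 by fact
  have "left_visit (renorm a \<psi>) \<gamma> (3 / l2) East"
    using bottom_visit_renorm[OF s1.glued s2.bottom_visit_North[OF assms(4,5)]] by simp
  from s1.all_bottom_visit[OF this]
  have "left_visit \<psi> \<gamma> (3 / l2 + 2 / l1) (above s)"
    using bottom_visit_renorm[OF s0.glued, of a \<gamma> _ "flip (above s)"] by simp
  then have "crossing \<psi> \<gamma> b (3 / l2 + 2 / l1 + 1 / l) s"
    using s0.left_visit_crossing(1) by fastforce
  moreover have "2 / l1 \<le> 2 / l2" "1 / l \<le> 1 / l2"
    using assms(6,7) s2.pos by (auto intro!: divide_left_mono)
  then have "3 / l2 + 2 / l1 + 1 / l \<le> 6 / l2" by (simp add: field_simps)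
  ultimately show ?thesis unfolding crossing_def by force
qed

text \<open>
  A segment of slope in \<open>{-1/2..0}\<close> and horizontal extent 3 traverses some square from
  left to right, and there it meets the trajectory.
\<close>

lemma segment_meets_trajectory:
  fixes X Y :: real
  assumes traj: "trajectory \<psi> \<gamma> l b" and cross: "\<And>s. crossing \<psi> \<gamma> b T s"
    and R: "chart \<psi> X (- Y) R" "additive R" "\<And>P P' r r'. R P P' r \<Longrightarrow> r \<le> r' \<Longrightarrow> R P P' r'"
    and X: "X > 0" and Y: "0 \<le> Y" "Y \<le> X / 2"
    and P: "covers \<psi> S" "P \<in> S"
  shows "\<exists>t\<in>{0..T + 1 / (l * b)}. R P (\<gamma> t) (3 / X)"
proof -
  interpret trajectory \<psi> \<gamma> l b by fact
  \<comment> \<open>Following the segment to the next right edge costs at most \<open>1 / X\<close>;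
    that edge is the left edge of a neighbouring square.\<close>
  have step: "R (strip \<psi> x y s) (\<psi> 0 (frac (y - (1 - x) / X * Y)) (right_of (climb \<lfloor>y - (1 - x) / X * Y\<rfloor> s))) (1 / X)"
    if "x \<in> {0..1}" for x y s
  proof -
    define y' where "y' = y + (1 - x) / X * (- Y)"
    have "R (strip \<psi> x y s) (strip \<psi> (x + (1 - x) / X * X) y' s) ((1 - x) / X)"
      unfolding y'_def using X that by (intro chart_strip[OF glued R(1,2)]) auto
    also have "x + (1 - x) / X * X = 1" using X by simp
    also have "strip \<psi> 1 y' s = \<psi> 0 (frac y') (right_of (climb \<lfloor>y'\<rfloor> s))"
      using gluedD(1)[OF glued] frac_ge_0[of y'] frac_lt_1[of y'] by (simp add: strip_def less_imp_le)
    finally have "R (strip \<psi> x y s) (\<psi> 0 (frac y') (right_of (climb \<lfloor>y'\<rfloor> s))) (1 / X)"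
      by (rule R(3)) (use X that in \<open>auto simp: divide_right_mono\<close>)
    then show ?thesis by (simp add: y'_def)
  qed
  have frac: "frac z \<in> {0..1}" for z :: real
    using frac_ge_0[of z] frac_lt_1[of z] by simp
  have trans: "R P P' r \<Longrightarrow> R P' P'' r' \<Longrightarrow> 0 \<le> r \<Longrightarrow> 0 \<le> r' \<Longrightarrow> R P P'' (r + r')" for P P' P'' r r'
    using R(2) unfolding additive_def by blast
  define k where "k = Y / X"
  have k: "0 \<le> k" "k \<le> 1 / 2" using X Y by (auto simp: k_def field_simps)
  obtain x y s where xy: "x \<in> {0..1}" "y \<in> {0..1}" "P = \<psi> x y s"
    using P unfolding covers_def by blast
  obtain y1 s1 where 1: "R P (\<psi> 0 y1 s1) (1 / X)" "y1 \<in> {0..1}"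
    using step[OF xy(1), of y s] strip_unit[OF glued xy(1,2), of s] xy(3) frac by metis
  \<comment> \<open>From height at least \<open>k\<close> the segment, of slope \<open>- k\<close>,
    crosses the whole square. From a lower height one more unit of width brings it to
    \<open>y1 - k + 1\<close>, which is at least \<open>k\<close> since
    \<open>k \<le> 1 / 2\<close>.\<close>
  obtain y2 s2 where 2: "R P (\<psi> 0 y2 s2) (2 / X)" "y2 \<in> {k..1}"
  proof (cases "y1 \<ge> k")
    case True
    have "R P (\<psi> 0 y1 s1) (2 / X)"
      by (rule R(3)[OF 1(1)]) (use X in \<open>simp add: divide_right_mono\<close>)
    with True 1(2) that show ?thesis by auto
  next
    case False
    then have "\<lfloor>y1 - k\<rfloor> = - 1" using 1(2) k by auto linarith
    then have "frac (y1 - k) = y1 - k + 1" by (simp add: frac_def)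
    then have "frac (y1 - k) \<in> {k..1}" using 1(2) k False by auto
    moreover have "R (\<psi> 0 y1 s1) (\<psi> 0 (frac (y1 - k)) (right_of (climb \<lfloor>y1 - k\<rfloor> s1))) (1 / X)"
      using step[of 0 y1 s1] strip_unit[OF glued _ 1(2)] by (simp add: k_def)
    from trans[OF 1(1) this]
    have "R P (\<psi> 0 (frac (y1 - k)) (right_of (climb \<lfloor>y1 - k\<rfloor> s1))) (2 / X)"
      using X by (simp flip: add_divide_distrib)
    ultimately show ?thesis using that by blast
  qed
  obtain t x0 where x0: "t \<in> {0..T}" "x0 \<in> {0..1 - 1 / b}" "\<gamma> t = \<psi> x0 0 s2"
    using cross[of s2] unfolding crossing_def by blast
  \<comment> \<open>Height of the intersection of the descending line \<open>y2 - k * x\<close> with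
    the trajectory, which is at \<open>x = x0 + \<eta> / b\<close> when it has height
    \<open>\<eta>\<close>.\<close>
  define \<eta> where "\<eta> = (y2 - k * x0) / (1 + k / b)"
  have b: "1 / b > 0" "k / b \<ge> 0" using slope k by auto
  have den: "1 + k / b > 0" using b by linarith
  have "x0 \<le> 1" using x0(2) b(1) unfolding atLeastAtMost_iff by linarith
  then have x0_le: "x0 \<in> {0..1}" using x0(2) by simp
  have "k * x0 \<le> k * 1" using k x0_le by (intro mult_left_mono) auto
  moreover have "k * x0 \<ge> 0" using k x0_le by simp
  ultimately have "0 \<le> y2 - k * x0" "y2 - k * x0 \<le> 1 + k / b"
    using 2(2) b(2) unfolding atLeastAtMost_iff by linarith+
  then have \<eta>: "\<eta> \<in> {0..1}" using den by (simp add: \<eta>_def)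
  have \<eta>_eq: "\<eta> = y2 - k * (x0 + \<eta> / b)"
  proof -
    have "\<eta> * (1 + k / b) = y2 - k * x0" using den by (simp add: \<eta>_def)
    then show ?thesis by (simp add: algebra_simps)
  qed
  have "\<eta> / b \<le> 1 / b" using \<eta> slope by (auto intro: divide_right_mono)
  moreover have "\<eta> / b \<ge> 0" using \<eta> slope by auto
  ultimately have x\<eta>: "x0 + \<eta> / b \<in> {0..1}" using x0(2) by auto
  have "\<gamma> (t + \<eta> / (l * b)) = \<psi> (x0 + \<eta> / (l * b) * l) (0 + \<eta> / (l * b) * (l * b)) s2"
    using x0 x0_le \<eta> x\<eta> pos slope by (intro move) auto
  then have J: "\<gamma> (t + \<eta> / (l * b)) = \<psi> (x0 + \<eta> / b) \<eta> s2"
    using pos slope by simp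
  have height: "y2 + (x0 + \<eta> / b) / X * (- Y) = \<eta>"
    using \<eta>_eq by (simp add: k_def mult.commute)
  have "R (\<psi> 0 y2 s2) (\<psi> (0 + (x0 + \<eta> / b) / X * X) (y2 + (x0 + \<eta> / b) / X * (- Y)) s2) ((x0 + \<eta> / b) / X)"
    unfolding height using X x\<eta> 2(2) k \<eta>
    by (intro chartD[OF R(1), where y = y2 and r = "(x0 + \<eta> / b) / X" and x = 0, unfolded height]) auto
  with height have "R (\<psi> 0 y2 s2) (\<gamma> (t + \<eta> / (l * b))) ((x0 + \<eta> / b) / X)"
    using J X by simp
  then have "R (\<psi> 0 y2 s2) (\<gamma> (t + \<eta> / (l * b))) (1 / X)"
    by (rule R(3)) (use x\<eta> X in \<open>simp add: divide_right_mono\<close>)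
  from trans[OF 2(1) this] have "R P (\<gamma> (t + \<eta> / (l * b))) (3 / X)"
    using X by (simp flip: add_divide_distrib)
  moreover have "\<eta> / (l * b) \<in> {0..1 / (l * b)}"
    using \<eta> pos slope by (auto intro: divide_right_mono)
  then have "t + \<eta> / (l * b) \<in> {0..T + 1 / (l * b)}" using x0(1) by auto
  ultimately show ?thesis by blast
qed

section \<open>The L-surface\<close>

fun offset :: "square \<Rightarrow> real \<times> real" where
  "offset Corner = (0, 0)" | "offset East = (1, 0)" | "offset North = (0, 1)"

definition L_sheets :: "(real \<times> real) set sheets" where
  "L_sheets x y s = L_class ((x, y) + offset s)"

lemma offset_in_L_shape: "x \<in> {0..1} \<Longrightarrow> y \<in> {0..1} \<Longrightarrow> (x, y) + offset s \<in> L_shape"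
  by (cases s) (auto simp: L_shape_def)

lemma glued_L_sheets: "glued L_sheets"
  unfolding glued_def
proof (intro allI ballI conjI)
  fix s and z :: real assume z: "z \<in> {0..1}"
  show "L_sheets 1 z s = L_sheets 0 z (right_of s)"
    unfolding L_sheets_def using z
    by (cases s) (auto intro!: L_class_eqI[symmetric] simp: L_glue_def)
  show "L_sheets z 1 s = L_sheets z 0 (above s)"
    unfolding L_sheets_def using z
    by (cases s) (auto intro!: L_class_eqI[symmetric] simp: L_glue_def)
qed

lemma covers_L_sheets: "covers L_sheets L_surface"
  unfolding covers_def
proof
  fix P assume "P \<in> L_surface"
  then obtain x y where P: "P = L_class (x, y)" and xy: "(x, y) \<in> L_shape"
    by (auto simp: L_surface_def L_class_def elim!: quotientE)
  from xy consider "x \<in> {0..1}" "y \<in> {0..1}" | "x \<in> {1..2}" "y \<in> {0..1}" | "x \<in> {0..1}" "y \<in> {1..2}"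
    by (auto simp: L_shape_def)
  then show "\<exists>x\<in>{0..1}. \<exists>y\<in>{0..1}. \<exists>s. P = L_sheets x y s"
  proof cases
    case 1
    then have "P = L_sheets x y Corner" by (simp add: L_sheets_def P)
    with 1 show ?thesis by blast
  next
    case 2
    then have "P = L_sheets (x - 1) y East" "x - 1 \<in> {0..1}" by (auto simp: L_sheets_def P)
    with 2 show ?thesis by blast
  next
    case 3
    then have "P = L_sheets x (y - 1) North" "y - 1 \<in> {0..1}" by (auto simp: L_sheets_def P)
    with 3 show ?thesis by blast
  qed
qed

section \<open>Broken paths and the flat distance\<close>

lemma L_path_trans: "L_path Q R m \<Longrightarrow> L_path P Q l \<Longrightarrow> L_path P R (l + m)"
proof (induction rule: L_path.induct)
  case (step Q R m p q)
  then show ?case using L_path.step[of P R "l + m" p q] by (simp add: add.assoc)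
qed simp

lemma L_dist_le: "L_path P Q l \<Longrightarrow> L_dist P Q \<le> l"
  unfolding L_dist_def by (rule cInf_lower) (auto intro!: bdd_belowI[of _ 0] L_path_nonneg)

lemma mem_L_class: "p \<in> L_shape \<Longrightarrow> p \<in> L_class p"
  unfolding L_class_def using equiv_class_self[OF equiv_L_rel] .

text \<open>The path runs from \<open>P'\<close> to \<open>P\<close>, matching
  \<open>L_dist (\<gamma> t) P\<close> when \<open>P'\<close> is on the geodesic. Allowing
  \<open>l \<le> r\<close> makes the relation monotone in \<open>r\<close>.\<close>

definition path_back :: "(real \<times> real) set \<Rightarrow> (real \<times> real) set \<Rightarrow> real \<Rightarrow> bool" where
  "path_back P P' r \<longleftrightarrow> (\<exists>l\<le>r. L_path P' P l)"

lemma additive_path_back: "additive path_back"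
  unfolding additive_def path_back_def
proof (intro allI impI, elim conjE exE)
  fix P P' P'' and r r' l l' :: real
  assume "l \<le> r" "L_path P' P l" "l' \<le> r'" "L_path P'' P' l'"
  then show "\<exists>l\<le>r + r'. L_path P'' P l"
    using L_path_trans[of P' P l P'' l'] by (intro exI[of _ "l' + l"]) auto
qed

lemma path_back_mono: "path_back P P' r \<Longrightarrow> r \<le> r' \<Longrightarrow> path_back P P' r'"
  unfolding path_back_def by (meson order_trans)

text \<open>Each square is convex, so the segment stays inside the L-shape although the latter is
  not convex. The norm bound makes its length at most \<open>r\<close>.\<close>

lemma chart_path_back:
  assumes "norm (u, w) \<le> 1"
  shows "chart L_sheets u w path_back"
  unfolding chart_def
proof (intro allI impI, elim conjE)
  fix x y s and r :: real
  assume *: "0 \<le> r" "x \<in> {0..1}" "y \<in> {0..1}" "x + r * u \<in> {0..1}" "y + r * w \<in> {0..1}"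
  define p where "p = (x, y) + offset s"
  define q where "q = (x + r * u, y + r * w) + offset s"
  have p: "p \<in> L_shape" and q: "q \<in> L_shape"
    unfolding p_def q_def using * offset_in_L_shape by blast+
  have "closed_segment q p \<subseteq> (\<lambda>z. z + offset s) ` ({0..1} \<times> {0..1})"
  proof (rule closed_segment_subset)
    have "convex ((\<lambda>z. offset s + z) ` ({0..1} \<times> {0..1::real}))"
      by (intro convex_translation convex_Times convex_real_interval)
    then show "convex ((\<lambda>z. z + offset s) ` ({0..1} \<times> {0..1::real}))"
      by (simp add: add.commute)
  qed (use * in \<open>auto simp: p_def q_def\<close>)
  also have "\<dots> \<subseteq> L_shape" using offset_in_L_shape by auto
  finally have seg: "closed_segment q p \<subseteq> L_shape" .
  have "L_path (L_class q) (L_class p) (0 + dist q p)"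
    using L_class_in_surface[OF q] mem_L_class[OF q] seg
    by (intro L_path.step[OF L_path.refl])
  moreover have "q - p = r *\<^sub>R (u, w)" by (simp add: p_def q_def)
  then have "dist q p = r * norm (u, w)" using * by (simp only: dist_norm norm_scaleR abs_of_nonneg)
  then have "dist q p \<le> r" using assms * by (simp add: mult_left_le)
  ultimately show "path_back (L_sheets x y s) (L_sheets (x + r * u) (y + r * w) s) r"
    unfolding path_back_def L_sheets_def p_def q_def by auto
qed

section \<open>Unique lifts of non-vertex geodesics\<close>

fun canon :: "real \<times> real \<Rightarrow> real \<times> real" where
  "canon (x, y) =
    (if x \<in> \<int> \<and> y \<in> \<int> then (0, 0)
     else if x = 2 \<or> x = 1 \<and> y > 1 then (0, y)
     else if y = 2 \<or> y = 1 \<and> x > 1 then (x, 0)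
     else (x, y))"

lemma canon_glue:
  assumes "(p, q) \<in> L_glue"
  shows "canon p = canon q"
proof -
  have "x \<in> {0, 1, 2}" if "x \<in> \<int>" "0 \<le> x" "x \<le> 2" for x :: real
    using that by (auto elim!: Ints_cases)
  moreover have "(2::real) \<in> \<int>" by simp
  ultimately show ?thesis using assms
    by (auto simp: L_glue_def)
qed

lemma canon_rtrancl: "(p, q) \<in> (L_glue \<union> L_glue\<inverse>)\<^sup>* \<Longrightarrow> canon p = canon q"
  by (induction rule: rtrancl_induct) (auto dest: canon_glue)

text \<open>Gives an invariant of classes without computing the generated equivalence:
  \<open>canon\<close> sends vertices to the origin and outer right and top edges to the edges glued
  to them.\<close>

lemma canon_L_class:
  assumes "L_class p = L_class q" "q \<in> L_shape"
  shows "canon p = canon q"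
  using mem_L_class[OF assms(2)] assms(1) canon_rtrancl
  unfolding L_class_def L_rel_def by blast

text \<open>From an outer right or top edge, any displacement up and to the right leaves the
  L-shape, so \<open>canon\<close> fixes the point.\<close>

lemma canon_extendable:
  assumes "p \<in> L_shape" "p + r *\<^sub>R (u, w) \<in> L_shape" "r > 0" "u > 0" "w > 0"
    "L_class p \<notin> L_vertices"
  shows "canon p = p"
proof -
  obtain x y where p: "p = (x, y)" by (cases p)
  have "\<not> (x \<in> \<int> \<and> y \<in> \<int>)" using assms(1,6) by (auto simp: p L_vertices_def)
  moreover have "r * u > 0" "r * w > 0" using assms by auto
  ultimately show ?thesis using assms(2) by (auto simp: p L_shape_def)
qed

lemma extendable_unique:
  assumes "p \<in> L_shape" "p + r *\<^sub>R (u, w) \<in> L_shape" "r > 0"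
    and "q \<in> L_shape" "q + r' *\<^sub>R (u, w) \<in> L_shape" "r' > 0"
    and "u > 0" "w > 0" "L_class p = L_class q" "L_class p \<notin> L_vertices"
  shows "p = q"
  using canon_L_class[OF assms(9,4)] canon_extendable[OF assms(1-3,7,8,10)]
    canon_extendable[OF assms(4-8)] assms(9,10) by simp

text \<open>Continuous induction: the supremum of the initial intervals on which \<open>g\<close>
  holds is attained by \<open>limit\<close>, and by \<open>forward\<close> it cannot be less than
  \<open>\<rho>\<close>.\<close>

lemma interval_induct:
  fixes \<rho> :: real
  assumes "\<rho> \<ge> 0" "g 0"
    and forward: "\<And>r. 0 \<le> r \<Longrightarrow> r < \<rho> \<Longrightarrow> g r \<Longrightarrow> \<exists>e>0. \<forall>s\<in>{0..e}. r + s \<le> \<rho> \<longrightarrow> g (r + s)"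
    and limit: "\<And>r. 0 < r \<Longrightarrow> r \<le> \<rho> \<Longrightarrow> (\<And>s. 0 \<le> s \<Longrightarrow> s < r \<Longrightarrow> g s) \<Longrightarrow> g r"
  shows "g \<rho>"
proof -
  define G where "G = {r \<in> {0..\<rho>}. \<forall>s\<in>{0..r}. g s}"
  define m where "m = Sup G"
  have G0: "0 \<in> G" using assms by (auto simp: G_def)
  have bdd: "bdd_above G" by (auto simp: G_def intro!: bdd_aboveI[of _ \<rho>])
  have m: "0 \<le> m" "m \<le> \<rho>"
    unfolding m_def using G0 bdd by (auto intro: cSup_upper) (rule cSup_least, auto simp: G_def)
  have below: "g s" if "0 \<le> s" "s < m" for s
  proof -
    have "\<exists>r\<in>G. s < r" using that(2) G0 bdd less_cSup_iff[of G s] unfolding m_def by blast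
    with that(1) show ?thesis by (auto simp: G_def)
  qed
  have gm: "g m"
    using limit[of m] below m assms(2) by (cases "m = 0") auto
  show ?thesis
  proof (cases "m = \<rho>")
    case False
    then obtain e where e: "e > 0" "\<And>s. s \<in> {0..e} \<Longrightarrow> m + s \<le> \<rho> \<Longrightarrow> g (m + s)"
      using forward[OF m(1) _ gm] m by force
    define r where "r = min \<rho> (m + e)"
    have "g s" if "s \<in> {0..r}" for s
    proof (cases "s < m")
      case False
      then show ?thesis using e(2)[of "s - m"] that by (auto simp: r_def)
    qed (use below that in auto)
    then have "r \<in> G" using m e by (auto simp: G_def r_def)
    then have "r \<le> m" unfolding m_def using bdd by (intro cSup_upper)
    with False e m show ?thesis by (auto simp: r_def)
  qed (use gm in simp)
qed

lemma slope_direction_eq: "slope_direction \<alpha> = (1 / norm (1::real, \<alpha>), 1 / norm (1::real, \<alpha>) * \<alpha>)"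
  by (simp add: slope_direction_def divide_inverse)

text \<open>Continuous induction propagates the straight lift through the square. The forward and
  backward local lifts of the geodesic supply the two induction steps, and
  \<open>extendable_unique\<close> matches them with the given lift.\<close>

lemma chart_geodesic:
  assumes "L_geodesic \<alpha> \<gamma>" "\<And>t. t \<ge> 0 \<Longrightarrow> \<gamma> t \<notin> L_vertices" "\<alpha> > 0"
  shows "chart L_sheets (1 / norm (1::real, \<alpha>)) (1 / norm (1::real, \<alpha>) * \<alpha>) (follows \<gamma>)"
  unfolding chart_def follows_def
proof (intro allI impI, elim conjE)
  define u where "u = 1 / norm (1::real, \<alpha>)"
  define d where "d = (u, u * \<alpha>)"
  have "norm (1::real, \<alpha>) > 0" by (simp add: prod_eq_iff)
  then have u: "u > 0" "u * \<alpha> > 0" using assms(3) by (auto simp: u_def simp del: norm_Pair)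
  have d: "slope_direction \<alpha> = d" by (simp add: slope_direction_eq d_def u_def)
  fix x y s and \<rho> t :: real
  assume *: "0 \<le> \<rho>" "x \<in> {0..1}" "y \<in> {0..1}"
    "x + \<rho> * (1 / norm (1::real, \<alpha>)) \<in> {0..1}" "y + \<rho> * (1 / norm (1::real, \<alpha>) * \<alpha>) \<in> {0..1}"
    and t: "0 \<le> t" "\<gamma> t = L_sheets x y s"
  note * = *(1-3) *(4,5)[folded u_def]
  define p where "p = (x, y) + offset s"
  have inL: "p + r *\<^sub>R d \<in> L_shape" if "0 \<le> r" "r \<le> \<rho>" for r
    using offset_in_L_shape[OF convex_unit[OF *(2,4) that] convex_unit[OF *(3,5) that], of s]
    by (simp add: p_def d_def algebra_simps)
  have "\<gamma> (t + \<rho>) = L_class (p + \<rho> *\<^sub>R d)"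
  proof (rule interval_induct[OF *(1), where g = "\<lambda>r. \<gamma> (t + r) = L_class (p + r *\<^sub>R d)"])
    show "\<gamma> (t + 0) = L_class (p + 0 *\<^sub>R d)" using t by (simp add: p_def L_sheets_def)
  next
    fix r assume r: "0 \<le> r" "r < \<rho>" "\<gamma> (t + r) = L_class (p + r *\<^sub>R d)"
    obtain q e where e: "e > 0" and
      q: "\<And>s. s \<in> {0..e} \<Longrightarrow> q + s *\<^sub>R d \<in> L_shape \<and> \<gamma> (t + r + s) = L_class (q + s *\<^sub>R d)"
      using assms(1) r(1) t(1) unfolding L_geodesic_def d by (metis add_nonneg_nonneg)
    have "p + r *\<^sub>R d = q"
    proof (rule extendable_unique[where r = "\<rho> - r" and r' = e and u = u and w = "u * \<alpha>"], fold d_def)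
      show "p + r *\<^sub>R d \<in> L_shape" "p + r *\<^sub>R d + (\<rho> - r) *\<^sub>R d \<in> L_shape"
        using inL[of r] inL[of \<rho>] r by (auto simp: algebra_simps)
      show "q \<in> L_shape" "q + e *\<^sub>R d \<in> L_shape" using q[of 0] q[of e] e by auto
      show "L_class (p + r *\<^sub>R d) = L_class q" using q[of 0] r e by simp
      show "L_class (p + r *\<^sub>R d) \<notin> L_vertices" using assms(2)[of "t + r"] r t by simp
    qed (use r e u in auto)
    with q e show "\<exists>e>0. \<forall>s\<in>{0..e}. r + s \<le> \<rho> \<longrightarrow> \<gamma> (t + (r + s)) = L_class (p + (r + s) *\<^sub>R d)"
      by (force simp: algebra_simps)
  next
    fix r assume r: "0 < r" "r \<le> \<rho>" and
      below: "\<And>s. 0 \<le> s \<Longrightarrow> s < r \<Longrightarrow> \<gamma> (t + s) = L_class (p + s *\<^sub>R d)"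
    have "t + r > 0" using r t by simp
    then obtain q e where e: "e > 0" and
      q: "\<And>s. s \<in> {0..e} \<Longrightarrow> q - s *\<^sub>R d \<in> L_shape \<and> \<gamma> (t + r - s) = L_class (q - s *\<^sub>R d)"
      using assms(1) unfolding L_geodesic_def d by metis
    \<comment> \<open>At time \<open>t + r\<close> the point may lie on an outer edge and have
      several representatives. The lifts are therefore compared a little earlier, where both extend
      up and to the right.\<close>
    define m where "m = min e r"
    have m: "m > 0" "m \<le> e" "m \<le> r" using e r by (auto simp: m_def)
    have 1: "\<gamma> (t + (r - m)) = L_class (p + (r - m) *\<^sub>R d)" using below[of "r - m"] m by simp
    have 2: "\<gamma> (t + (r - m)) = L_class (q - m *\<^sub>R d)" using q[of m] m by (simp add: algebra_simps)
    have "p + (r - m) *\<^sub>R d = q - m *\<^sub>R d"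
    proof (rule extendable_unique[where r = m and r' = m and u = u and w = "u * \<alpha>"], fold d_def)
      show "p + (r - m) *\<^sub>R d \<in> L_shape" "p + (r - m) *\<^sub>R d + m *\<^sub>R d \<in> L_shape"
        using inL[of r] inL[of "r - m"] r m by (auto simp: algebra_simps)
      show "q - m *\<^sub>R d \<in> L_shape" "q - m *\<^sub>R d + m *\<^sub>R d \<in> L_shape"
        using q[of 0] q[of m] m by auto
      show "L_class (p + (r - m) *\<^sub>R d) = L_class (q - m *\<^sub>R d)" using 1 2 by simp
      show "L_class (p + (r - m) *\<^sub>R d) \<notin> L_vertices"
        using assms(2)[of "t + (r - m)"] 1 m t by simp
    qed (use m u in auto)
    then have "q = p + r *\<^sub>R d" by (simp add: algebra_simps)
    with q[of 0] e show "\<gamma> (t + r) = L_class (p + r *\<^sub>R d)" by simp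
  qed
  then show "\<gamma> (t + \<rho>) = L_sheets (x + \<rho> * (1 / norm (1::real, \<alpha>))) (y + \<rho> * (1 / norm (1::real, \<alpha>) * \<alpha>)) s"
    by (simp add: L_sheets_def p_def d_def algebra_simps flip: u_def)
qed

section \<open>Renormalization of the L-surface\<close>

primrec stage :: "(nat \<Rightarrow> int) \<Rightarrow> nat \<Rightarrow> (real \<times> real) set sheets" where
  "stage a 0 = L_sheets"
| "stage a (Suc k) = renorm (a k) (stage a k)"

text \<open>Horizontal speed of the geodesic in the coordinates of \<open>stage a k\<close>. The
  division multiplies by \<open>x k - a k\<close>: the vertical speed left after the shear becomes
  the new horizontal speed.\<close>

primrec speed :: "real \<Rightarrow> (nat \<Rightarrow> int) \<Rightarrow> nat \<Rightarrow> real" where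
  "speed \<alpha> a 0 = 1 / norm (1::real, \<alpha>)"
| "speed \<alpha> a (Suc k) = speed \<alpha> a k / complete_quotient \<alpha> a (Suc k)"

text \<open>Up to signs, the unit vertical vector in the coordinates of \<open>stage a k\<close>.\<close>

primrec vertical :: "(nat \<Rightarrow> int) \<Rightarrow> nat \<Rightarrow> real \<times> real" where
  "vertical a 0 = (0, 1)"
| "vertical a (Suc k) =
    (snd (vertical a k) + of_int (a k) * fst (vertical a k), fst (vertical a k))"

section \<open>Estimates along an even expansion with bounded digits\<close>

locale even_cfrac =
  fixes \<alpha> :: real and a :: "nat \<Rightarrow> int" and A :: real
  assumes cfrac: "has_cfrac \<alpha> a"
    and pos: "\<And>i. a i > 0" and even: "\<And>i. even (a i)" and le: "\<And>i. of_int (a i) \<le> A"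
begin

abbreviation "x \<equiv> complete_quotient \<alpha> a"
abbreviation "l \<equiv> speed \<alpha> a"
abbreviation "X k \<equiv> fst (vertical a k)"
abbreviation "Y k \<equiv> snd (vertical a k)"

lemma digit_ge: "of_int (a k) \<ge> (2::real)"
proof -
  have "a k \<ge> 2" using pos[of k] even[of k] by presburger
  then show ?thesis by linarith
qed

lemma x_bounds: "x k \<ge> 2" "x k \<le> A + 1" "x k > of_int (a k)"
  using complete_quotient_bounds[OF cfrac, of k] digit_ge[of k] le[of k] by linarith+

lemma speed_pos: "l k > 0"
proof (induction k)
  case (Suc k)
  then show ?case using x_bounds(3)[of k] by simp
qed (simp add: prod_eq_iff)

text \<open>The halving makes every small scale reachable; the lower bound, due to bounded digits,
  keeps consecutive scales comparable.\<close>

lemma speed_Suc: "l (Suc k) \<le> l k / 2" "l k / (A + 1) \<le> l (Suc k)"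
proof -
  note x = x_bounds(1,2)[of "Suc k"]
  have "l k / x (Suc k) \<le> l k / 2"
    using x speed_pos[of k] x_bounds(3)[of k] by (intro divide_left_mono) auto
  moreover have "l k / (A + 1) \<le> l k / x (Suc k)"
    using x speed_pos[of k] x_bounds(3)[of k] le[of k] digit_ge[of k]
    by (intro divide_left_mono) auto
  ultimately show "l (Suc k) \<le> l k / 2" "l k / (A + 1) \<le> l (Suc k)"
    by (simp_all del: complete_quotient.simps)
qed

lemma speed_decreasing: "l (Suc k) \<le> l k"
  using speed_Suc(1)[of k] speed_pos[of k] by simp

lemma speed_le: "l k \<le> l 0 * (1 / 2) ^ k"
proof (induction k)
  case (Suc k)
  then show ?case using speed_Suc(1)[of k] by (simp del: speed.simps)
qed simp

lemma vertical_nonneg: "X k \<ge> 0 \<and> Y k \<ge> 0"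
proof (induction k)
  case (Suc k)
  then show ?case using digit_ge[of k] by simp
qed simp

text \<open>Provides the slope condition of \<open>segment_meets_trajectory\<close> from stage 1 on;
  at stage 0 the vector is still vertical.\<close>

lemma vertical_flat: "Y (Suc k) \<le> X (Suc k) / 2"
proof -
  have "2 * X k \<le> of_int (a k) * X k"
    using digit_ge[of k] vertical_nonneg[of k] by (intro mult_right_mono) auto
  then show ?thesis using vertical_nonneg[of k] by simp
qed

text \<open>Invariance of the determinant of the flow direction and the vertical direction.\<close>

lemma determinant: "l k * (Y k + x k * X k) = 1 / norm (1::real, \<alpha>)"
proof (induction k)
  case (Suc k)
  define z where "z = x (Suc k)"
  have z: "z > 0" using x_bounds(3)[of k] by (simp add: z_def)
  have "z = 1 / (x k - of_int (a k))" by (simp add: z_def)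
  then have "x k = of_int (a k) + 1 / z" using x_bounds(3)[of k] by simp
  moreover have "l (Suc k) = l k / z" by (simp add: z_def)
  moreover have "l k / z * (X k + z * (Y k + of_int (a k) * X k))
      = l k * (Y k + (of_int (a k) + 1 / z) * X k)"
    using z by (simp add: field_simps)
  ultimately have "l (Suc k) * (Y (Suc k) + z * X (Suc k)) = l k * (Y k + x k * X k)"
    by simp
  then show ?case using Suc by (simp add: z_def)
qed simp

lemma glued_stage: "glued (stage a k)"
  by (induction k) (auto simp: glued_L_sheets even intro: glued_renorm)

lemma covers_stage: "covers (stage a k) L_surface"
  by (induction k) (auto simp: covers_L_sheets intro: covers_renorm glued_stage)

text \<open>One renormalization turns \<open>(X, - Y)\<close> into the negative of the next such
  vector, so both signs are carried through the induction.\<close>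

lemma chart_stage_path_back:
  "chart (stage a k) (X k) (- Y k) path_back \<and> chart (stage a k) (- X k) (Y k) path_back"
proof (induction k)
  case 0
  show ?case by (simp add: chart_path_back)
next
  case (Suc k)
  note step = chart_renorm[OF glued_stage _ additive_path_back, where a = "a k"]
  from step[OF conjunct1[OF Suc]] step[OF conjunct2[OF Suc]] show ?case
    by (simp add: algebra_simps)
qed

lemma trajectory_stage:
  assumes "L_geodesic \<alpha> \<gamma>" "\<And>t. t \<ge> 0 \<Longrightarrow> \<gamma> t \<notin> L_vertices"
  shows "trajectory (stage a k) \<gamma> (l k) (x k)"
proof
  show "chart (stage a k) (l k) (l k * x k) (follows \<gamma>)"
  proof (induction k)
    case 0
    show ?case using chart_geodesic[OF assms] x_bounds(1)[of 0] by simp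
  next
    case (Suc k)
    have "l (Suc k) = l k * x k - of_int (a k) * l k" "l (Suc k) * x (Suc k) = l k"
      using x_bounds(3)[of k] by (simp_all add: field_simps)
    then show ?case
      using chart_renorm[OF glued_stage Suc additive_follows, of "a k"] by simp
  qed
qed (use glued_stage speed_pos x_bounds in auto)

text \<open>The crossings of all squares take time \<open>6 / l (k + 2)\<close>, and the ascent
  inside the meeting square at most one more \<open>1 / l (k + 2)\<close>. A vertical segment of
  length \<open>3 / X k\<close> has horizontal extent 3 at stage \<open>k\<close>.\<close>

lemma geodesic_meets_vertical:
  assumes \<gamma>: "L_geodesic \<alpha> \<gamma>" "\<And>t. t \<ge> 0 \<Longrightarrow> \<gamma> t \<notin> L_vertices"
    and P: "P \<in> L_surface" and k: "k > 0"
  shows "\<exists>t\<in>{0..7 / l (k + 2)}. L_dist (\<gamma> t) P \<le> 3 / X k"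
proof -
  obtain p where p: "p \<in> L_shape" "\<gamma> 0 = L_class p"
  proof -
    obtain p e where "e > 0" "\<forall>s\<in>{0..e}. p + s *\<^sub>R slope_direction \<alpha> \<in> L_shape \<and>
        \<gamma> (0 + s) = L_class (p + s *\<^sub>R slope_direction \<alpha>)"
      using \<gamma>(1) unfolding L_geodesic_def by blast
    then show ?thesis using that[of p] by (force dest: bspec[of _ _ 0])
  qed
  note traj = trajectory_stage[OF \<gamma>]
  have cross: "crossing (stage a k) \<gamma> (x k) (6 / l (k + 2)) s" for s
    using all_crossings[of "stage a k" \<gamma> "l k" "x k" "a k" "l (Suc k)" "x (Suc k)" "a (Suc k)"
        "l (k + 2)" "x (k + 2)" L_surface s]
      traj[of k] traj[of "Suc k"] traj[of "k + 2"] covers_stage[of "k + 2"]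
      speed_decreasing[of k] speed_decreasing[of "Suc k"] p L_class_in_surface[of p]
    by (simp del: speed.simps complete_quotient.simps)
  have flat: "Y k \<le> X k / 2" using vertical_flat[of "k - 1"] k by simp
  moreover have "X k \<noteq> 0"
  proof
    assume "X k = 0"
    with flat vertical_nonneg[of k] have "Y k = 0" by simp
    with \<open>X k = 0\<close> determinant[of k] show False by (simp add: prod_eq_iff)
  qed
  ultimately obtain t where t: "t \<in> {0..6 / l (k + 2) + 1 / (l k * x k)}" "path_back P (\<gamma> t) (3 / X k)"
    using segment_meets_trajectory[OF traj cross conjunct1[OF chart_stage_path_back]
        additive_path_back path_back_mono _ _ _ covers_stage P] vertical_nonneg[of k]
    by force
  have "l (k + 2) * 1 \<le> l k * x k"
    using speed_decreasing[of k] speed_decreasing[of "Suc k"] x_bounds(1)[of k] speed_pos[of k]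
    by (intro mult_mono) (auto simp del: speed.simps complete_quotient.simps)
  then have "1 / (l k * x k) \<le> 1 / l (k + 2)"
    using speed_pos[of "k + 2"] speed_pos[of k] x_bounds(1)[of k]
    by (intro divide_left_mono) (auto intro!: mult_pos_pos simp del: speed.simps)
  then have "t \<in> {0..7 / l (k + 2)}" using t(1) by (auto simp del: speed.simps)
  then show ?thesis
    using t(2) unfolding path_back_def by (meson L_dist_le order_trans)
qed

text \<open>By \<open>determinant\<close>, \<open>l k * (Y k + x k * X k)\<close> is constant, while
  \<open>Y k \<le> X k\<close> and \<open>x k \<le> A + 1\<close>. Hence \<open>X k\<close> is at
  least a constant multiple of \<open>1 / l k\<close>.\<close>

lemma vertical_scale:
  assumes "k > 0"
  shows "3 / X k \<le> 3 * norm (1::real, \<alpha>) * (A + 2) * l k"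
proof -
  define N where "N = norm (1::real, \<alpha>)"
  have N: "N > 0" by (simp add: N_def prod_eq_iff)
  have "Y k + x k * X k \<le> X k + (A + 1) * X k"
    using vertical_flat[of "k - 1"] assms vertical_nonneg[of k] x_bounds(2)[of k]
    by (intro add_mono mult_right_mono) auto
  then have "l k * (Y k + x k * X k) \<le> l k * (X k + (A + 1) * X k)"
    using speed_pos[of k] by (intro mult_left_mono) auto
  then have "1 / N \<le> l k * (X k + (A + 1) * X k)"
    using determinant[of k] by (simp add: N_def)
  then have *: "1 \<le> N * (A + 2) * l k * X k"
    using N by (simp add: field_simps)
  then have "X k \<noteq> 0" by auto
  then have "X k > 0" using vertical_nonneg[of k] by simp
  with * show ?thesis by (simp add: N_def[symmetric] field_simps)
qed

text \<open>For the least \<open>k\<close> with \<open>l k \<le> c\<close> the previous speed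
  exceeds \<open>c\<close>, and the three steps up to \<open>k + 2\<close> each lose a factor of at
  most \<open>A + 1\<close>. The condition \<open>c < l 0\<close> forces
  \<open>k > 0\<close>.\<close>

lemma ex_scale:
  assumes "c > 0" "c < l 0"
  shows "\<exists>k>0. l k \<le> c \<and> l (k + 2) \<ge> c / (A + 1) ^ 3"
proof -
  obtain m where "l 0 * (1 / 2) ^ m \<le> c"
  proof -
    obtain m where "(1 / 2 :: real) ^ m < c / l 0"
      using real_arch_pow_inv[of "c / l 0" "1 / 2"] assms speed_pos[of 0] by auto
    then show ?thesis using that[of m] speed_pos[of 0] by (simp add: field_simps)
  qed
  then have "l m \<le> c" using speed_le[of m] by linarith
  define k where "k = (LEAST k. l k \<le> c)"
  have k: "l k \<le> c" unfolding k_def using \<open>l m \<le> c\<close> by (rule LeastI)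
  then have "k \<noteq> 0" using assms(2) by (metis not_less)
  then obtain j where j: "k = Suc j" by (cases k) auto
  then have "\<not> l j \<le> c" unfolding k_def using not_less_Least[of j] by (metis k_def lessI)
  have A: "A + 1 > 0" using x_bounds[of 0] by linarith
  have "c / (A + 1) ^ 3 \<le> l j / (A + 1) / (A + 1) / (A + 1)"
    using A \<open>\<not> l j \<le> c\<close> by (simp add: power3_eq_cube divide_right_mono)
  also have "\<dots> \<le> l k / (A + 1) / (A + 1)"
    using A speed_Suc(2)[of j] unfolding j by (intro divide_right_mono) auto
  also have "\<dots> \<le> l (Suc k) / (A + 1)"
    using A speed_Suc(2)[of k] by (intro divide_right_mono) auto
  also have "\<dots> \<le> l (k + 2)" using speed_Suc(2)[of "Suc k"] by (simp del: speed.simps)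
  finally show ?thesis using k \<open>k \<noteq> 0\<close> by blast
qed

end

theorem theorem6p1p1:
  fixes \<alpha> :: real and a :: "nat \<Rightarrow> int"
  assumes "\<alpha> > 1"
    and "badly_approximable \<alpha>"
    and "has_cfrac \<alpha> a"
    and "\<And>i. a i > 0 \<and> even (a i)"
  shows "\<exists>C>0. \<forall>\<gamma>. L_geodesic \<alpha> \<gamma> \<and> (\<forall>t\<ge>0. \<gamma> t \<notin> L_vertices) \<longrightarrow>
           (\<forall>n::nat. n \<ge> 1 \<longrightarrow> (\<forall>P\<in>L_surface. \<exists>t\<in>{0..C * real n}. L_dist (\<gamma> t) P \<le> 1 / real n))"
proof -
  obtain M where M: "\<And>i. a i \<le> M"
    using assms(2,3) has_cfrac_unique unfolding badly_approximable_def bdd_above_def by blast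
  interpret even_cfrac \<alpha> a "of_int M"
    using assms M by unfold_locales auto
  define A where "A = (of_int M :: real)"
  define N where "N = norm (1::real, \<alpha>)"
  \<comment> \<open>Chosen so that \<open>vertical_scale\<close> reads
    \<open>3 / X k \<le> l k / c\<close>.\<close>
  define c where "c = 1 / (3 * N * (A + 2))"
  have N: "N > 0" by (simp add: N_def prod_eq_iff)
  have A: "A \<ge> 2" using le[of 0] digit_ge[of 0] by (simp add: A_def)
  have c: "c > 0" using N A by (simp add: c_def)
  have c_less: "c < l 0"
  proof -
    have "N * 1 < N * (3 * (A + 2))" using A N by (intro mult_strict_left_mono) auto
    then have "1 / (N * (3 * (A + 2))) < 1 / N"
      using A N by (intro divide_strict_left_mono) auto
    then show ?thesis by (simp add: c_def mult_ac flip: N_def)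
  qed
  show ?thesis
  \<comment> \<open>At the scale \<open>c / n\<close> the distance becomes at most
    \<open>1 / n\<close>, while the time \<open>7 / l (k + 2)\<close> is at most
    \<open>7 * (A + 1) ^ 3 * n / c\<close>.\<close>
  proof (intro exI[of _ "7 * (A + 1) ^ 3 / c"] conjI allI impI ballI; (elim conjE)?)
    show "7 * (A + 1) ^ 3 / c > 0" using A c by simp
    fix \<gamma> P and n :: nat
    assume \<gamma>: "L_geodesic \<alpha> \<gamma>" "\<forall>t\<ge>0. \<gamma> t \<notin> L_vertices" and n: "n \<ge> 1" and P: "P \<in> L_surface"
    have "c / n \<le> c" using c n by (simp add: divide_le_eq)
    then obtain k where k: "k > 0" "l k \<le> c / n" "l (k + 2) \<ge> c / n / (A + 1) ^ 3"
      using ex_scale[of "c / n"] c c_less n unfolding A_def by auto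
    obtain t where t: "t \<in> {0..7 / l (k + 2)}" "L_dist (\<gamma> t) P \<le> 3 / X k"
      using geodesic_meets_vertical[OF \<gamma>(1) _ P k(1)] \<gamma>(2) by blast
    have "3 / X k \<le> 1 / c * l k"
      using vertical_scale[OF k(1)] by (simp add: c_def A_def N_def)
    also have "\<dots> \<le> 1 / c * (c / n)" using k(2) c by (intro mult_left_mono) auto
    finally have "3 / X k \<le> 1 / n" using c by simp
    moreover have "7 / l (k + 2) \<le> 7 / (c / n / (A + 1) ^ 3)"
      using k(3) c A n by (intro divide_left_mono) (auto intro!: mult_pos_pos divide_pos_pos speed_pos simp del: speed.simps)
    then have "7 / l (k + 2) \<le> 7 * (A + 1) ^ 3 / c * n" by (simp add: field_simps)
    ultimately show "\<exists>t\<in>{0..7 * (A + 1) ^ 3 / c * n}. L_dist (\<gamma> t) P \<le> 1 / n"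
      using t by force
  qed
qed

end
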